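(* Consider the R-ESAV-1/BDF$k$ scheme ($k=1$ or $k=2$) for the gradient flow $\partial_t\phi=-\mathcal G\mu$, $\mu=\mathcal L\phi+F'(\phi)$, as defined in the context, with time step $\delta t>0$ and parameter $\gamma\in[0,1]$. At each time step let $(\phi^{n+1},\mu^{n+1},\tilde r^{n+1})$ be the output of Step 1, and set $$S=\exp\big(\delta t\,\gamma(\mathcal G\mu^{n+1},\mu^{n+1})+\ln(\tilde r^{n+1})\big)\ \text{ if }k=1,\qquad S=\exp\big(\tfrac23\delta t\,\gamma(\mathcal G\mu^{n+1},\mu^{n+1})+\ln(\tilde r^{n+1})\big)\ \text{ if }k=2.$$ Choose $\theta_0^{n+1}$ in Step 2 as follows: 1. If $\tilde r^{n+1}=\exp(E_1(\phi^{n+1}))$, set $\theta_0^{n+1}=0$. 2. If $\tilde r^{n+1}>\exp(E_1(\phi^{n+1}))$, set $\theta_0^{n+1}=0$. 3. If $\tilde r^{n+1}<\exp(E_1(\phi^{n+1}))$ and $S-\exp(E_1(\phi^{n+1}))\ge 0$, set $\theta_0^{n+1}=0$. 4. If $\tilde r^{n+1}<\exp(E_1(\phi^{n+1}))$ and $S-\exp(E_1(\phi^{n+1}))<0$, set $\theta_0^{n+1}=\dfrac{S-\exp(E_1(\phi^{n+1}))}{\tilde r^{n+1}-\exp(E_1(\phi^{n+1}))}$. Then in all cases $$\big(\tilde r^{n+1}-\exp(E_1(\phi^{n+1}))\big)\theta_0^{n+1}\le S-\exp(E_1(\phi^{n+1}))$$ and $\theta_0^{n+1}\in\mathcal W$.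 Moreover $r^{n+1}>0$, and the scheme with this choice of $\theta_0^{n+1}$ is unconditionally energy stable (for every $\delta t>0$) in the following sense. For $k=1$: $$R_1^{n+1}-R_1^{n}\le-\delta t(1-\gamma)(\mathcal G\mu^{n+1},\mu^{n+1})\le 0,\qquad R_1^{n+1}=\tfrac12(\mathcal L\phi^{n+1},\phi^{n+1})+\ln(r^{n+1}).$$ For $k=2$: $$R_2^{n+1}-R_2^{n}\le-\delta t(1-\gamma)(\mathcal G\mu^{n+1},\mu^{n+1})\le 0,$$ $$R_2^{n+1}=\tfrac14\Big((\mathcal L\phi^{n+1},\phi^{n+1})+\big(\mathcal L(2\phi^{n+1}-\phi^n),2\phi^{n+1}-\phi^n\big)\Big)+\tfrac12\big(3\ln(r^{n+1})-\ln(r^n)\big).$$ Furthermore, $r^{n+1}\le\exp(E_1(\phi^{n+1}))$ for all $n\ge0$ (that is, at every time step computed by the scheme).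
   Context: Setting. $(\cdot,\cdot)$ is the $L^2(\Omega)$ inner product. $\mathcal L$ is a self-adjoint linear elliptic operator, so that $(\mathcal L\phi,\phi)\ge 0$. $\mathcal G$ is a linear positive definite operator (e.g. $\mathcal G=I$ or $\mathcal G=-\Delta$), so $(\mathcal G\mu,\mu)\ge0$. $F$ is a nonlinear energy density function, $E_1(\phi)=\int_\Omega F(\phi)\,d\boldsymbol x$, and $E(\phi)=\frac12(\mathcal L\phi,\phi)+E_1(\phi)$. All functions are assumed to lie in spaces (with suitable, e.g. periodic, boundary conditions) where the expressions below make sense. Set $$U(r,\phi)=\frac{r}{\exp(E_1(\phi))}F'(\phi).$$ BDF operators (applied to any sequence, of functions or of real numbers). For $k=1$: $\alpha_1=1$, $A_1(g^n)=g^n$, $B_1(g^n)=g^n$. For $k=2$: $\alpha_2=\frac32$, $A_2(g^n)=2g^n-\frac12 g^{n-1}$, $B_2(g^n)=2g^n-g^{n-1}$. R-ESAV-1/BDF$k$ scheme. The previous values $\phi^n,r^n$ (and $\phi^{n-1},r^{n-1}$ when $k=2$) are given, with positive $r$-values; $r$ is a discretization of the scalar auxiliary variable $r(t)=\exp(E_1(\phi(t)))$. Step 1: find $(\phi^{n+1},\mu^{n+1},\tilde r^{n+1})$ satisfying $$\frac{\alpha_k\phi^{n+1}-A_k(\phi^n)}{\delta t}=-\mathcal G\mu^{n+1},\qquad \mu^{n+1}=\mathcal L\phi^{n+1}+U\big(B_k(r^n),B_k(\phi^n)\big),$$ $$\frac{\alpha_k\ln(\tilde r^{n+1})-A_k(\ln(r^n))}{\delta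 t}=\Big(U\big(B_k(r^n),B_k(\phi^n)\big),\frac{\alpha_k\phi^{n+1}-A_k(\phi^n)}{\delta t}\Big).$$ Step 2: set $r^{n+1}=\theta_0^{n+1}\tilde r^{n+1}+(1-\theta_0^{n+1})\exp(E_1(\phi^{n+1}))$ with $\theta_0^{n+1}\in\mathcal W$. Here $\mathcal W$ is the set of $\theta\in[0,1]$ such that $r_\theta:=\theta\tilde r^{n+1}+(1-\theta)\exp(E_1(\phi^{n+1}))$ satisfies $$\alpha_k\ln(r_\theta)-\alpha_k\ln(\tilde r^{n+1})\le\delta t\,\gamma\,(\mathcal G\mu^{n+1},\mu^{n+1}),$$ where $\gamma\in[0,1]$ is a fixed adjustable parameter. *)

theory Defs
  imports "HOL-Analysis.Analysis"
begin

section \<open>The space $L^2(\Omega)$ and linear operators in it\<close>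

text \<open>
  Functions on \<open>\<Omega>\<close> are represented by functions on the ambient Euclidean space; only their
  values almost everywhere on \<open>\<Omega>\<close> matter.
\<close>

definition L2 :: "'a::euclidean_space set \<Rightarrow> ('a \<Rightarrow> real) set" where
  "L2 \<Omega> = {f. f \<in> borel_measurable (lebesgue_on \<Omega>) \<and>
              integrable (lebesgue_on \<Omega>) (\<lambda>x. (f x)\<^sup>2)}"

definition L2_inner :: "'a::euclidean_space set \<Rightarrow> ('a \<Rightarrow> real) \<Rightarrow> ('a \<Rightarrow> real) \<Rightarrow> real" where
  "L2_inner \<Omega> f g = (LINT x|lebesgue_on \<Omega>. f x * g x)"

definition ae_eq :: "'a::euclidean_space set \<Rightarrow> ('a \<Rightarrow> real) \<Rightarrow> ('a \<Rightarrow> real) \<Rightarrow> bool" where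
  "ae_eq \<Omega> f g \<longleftrightarrow> (AE x in lebesgue_on \<Omega>. f x = g x)"

text \<open>
  A possibly unbounded linear operator \<open>T\<close> with domain \<open>D\<close>, a linear subspace of $L^2(\Omega)$.
  Regularity and boundary conditions are encoded in \<open>D\<close>, which may consist of classical functions
  or of Sobolev functions; the last clause says that \<open>T\<close> acts on classes of functions modulo
  null sets.
\<close>

definition linear_operator_on ::
    "'a::euclidean_space set \<Rightarrow> ('a \<Rightarrow> real) set \<Rightarrow> (('a \<Rightarrow> real) \<Rightarrow> 'a \<Rightarrow> real) \<Rightarrow> bool" where
  "linear_operator_on \<Omega> D T \<longleftrightarrow>
     D \<subseteq> L2 \<Omega> \<and> T ` D \<subseteq> L2 \<Omega> \<and>
     (\<lambda>x. 0) \<in> D \<and>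
     (\<forall>f\<in>D. \<forall>g\<in>D. (\<lambda>x. f x + g x) \<in> D \<and>
        ae_eq \<Omega> (T (\<lambda>x. f x + g x)) (\<lambda>x. T f x + T g x)) \<and>
     (\<forall>f\<in>D. \<forall>c. (\<lambda>x. c * f x) \<in> D \<and>
        ae_eq \<Omega> (T (\<lambda>x. c * f x)) (\<lambda>x. c * T f x)) \<and>
     (\<forall>f\<in>D. \<forall>g\<in>D. ae_eq \<Omega> f g \<longrightarrow> ae_eq \<Omega> (T f) (T g))"

text \<open>
  Self-adjointness is understood formally, that is, as symmetry on the given function space.
\<close>

definition self_adjoint_on ::
    "'a::euclidean_space set \<Rightarrow> ('a \<Rightarrow> real) set \<Rightarrow> (('a \<Rightarrow> real) \<Rightarrow> 'a \<Rightarrow> real) \<Rightarrow> bool" where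
  "self_adjoint_on \<Omega> D T \<longleftrightarrow> (\<forall>f\<in>D. \<forall>g\<in>D. L2_inner \<Omega> (T f) g = L2_inner \<Omega> f (T g))"

text \<open>
  Nonnegativity is how both the ellipticity of \<open>\<L>\<close> and the positive definiteness of \<open>\<G>\<close> enter.
  Strict positivity is not required: $-\Delta$ with periodic boundary conditions has the constants
  in its kernel.
\<close>

definition nonnegative_on ::
    "'a::euclidean_space set \<Rightarrow> ('a \<Rightarrow> real) set \<Rightarrow> (('a \<Rightarrow> real) \<Rightarrow> 'a \<Rightarrow> real) \<Rightarrow> bool" where
  "nonnegative_on \<Omega> D T \<longleftrightarrow> (\<forall>f\<in>D. 0 \<le> L2_inner \<Omega> (T f) f)"

section \<open>The nonlinear energy\<close>

definition E1 :: "'a::euclidean_space set \<Rightarrow> (real \<Rightarrow> real) \<Rightarrow> ('a \<Rightarrow> real) \<Rightarrow> real" where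
  "E1 \<Omega> F \<phi> = (LINT x|lebesgue_on \<Omega>. F (\<phi> x))"

definition U :: "'a::euclidean_space set \<Rightarrow> (real \<Rightarrow> real) \<Rightarrow> real \<Rightarrow> ('a \<Rightarrow> real) \<Rightarrow> 'a \<Rightarrow> real" where
  "U \<Omega> F r \<phi> = (\<lambda>x. r / exp (E1 \<Omega> F \<phi>) * deriv F (\<phi> x))"

text \<open>
  The conditions under which $E_1(\phi)$ and $F'(\phi)\in L^2(\Omega)$ make sense.
  Differentiability of \<open>F\<close> is only asked for at values of \<open>\<phi>\<close>, so that singular (for example
  logarithmic) energy densities are covered.
\<close>

definition E1_defined :: "'a::euclidean_space set \<Rightarrow> (real \<Rightarrow> real) \<Rightarrow> ('a \<Rightarrow> real) \<Rightarrow> bool" where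
  "E1_defined \<Omega> F \<phi> \<longleftrightarrow> integrable (lebesgue_on \<Omega>) (\<lambda>x. F (\<phi> x))"

definition U_defined :: "'a::euclidean_space set \<Rightarrow> (real \<Rightarrow> real) \<Rightarrow> ('a \<Rightarrow> real) \<Rightarrow> bool" where
  "U_defined \<Omega> F \<phi> \<longleftrightarrow> E1_defined \<Omega> F \<phi> \<and>
     (AE x in lebesgue_on \<Omega>. F differentiable (at (\<phi> x))) \<and>
     (\<lambda>x. deriv F (\<phi> x)) \<in> L2 \<Omega>"

section \<open>The R-ESAV-1/BDF$k$ scheme\<close>

text \<open>
  The BDF operators, for \<open>k = 1\<close> and (otherwise) \<open>k = 2\<close>. For sequences of functions they are
  applied pointwise.
\<close>

definition bdf_alpha :: "nat \<Rightarrow> real" where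
  "bdf_alpha k = (if k = 1 then 1 else 3/2)"

definition bdf_A :: "nat \<Rightarrow> (nat \<Rightarrow> real) \<Rightarrow> nat \<Rightarrow> real" where
  "bdf_A k g n = (if k = 1 then g n else 2 * g n - 1/2 * g (n - 1))"

definition bdf_B :: "nat \<Rightarrow> (nat \<Rightarrow> real) \<Rightarrow> nat \<Rightarrow> real" where
  "bdf_B k g n = (if k = 1 then g n else 2 * g n - g (n - 1))"

definition bdf_A_fun :: "nat \<Rightarrow> (nat \<Rightarrow> 'a \<Rightarrow> real) \<Rightarrow> nat \<Rightarrow> 'a \<Rightarrow> real" where
  "bdf_A_fun k g n = (\<lambda>x. bdf_A k (\<lambda>m. g m x) n)"

definition bdf_B_fun :: "nat \<Rightarrow> (nat \<Rightarrow> 'a \<Rightarrow> real) \<Rightarrow> nat \<Rightarrow> 'a \<Rightarrow> real" where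
  "bdf_B_fun k g n = (\<lambda>x. bdf_B k (\<lambda>m. g m x) n)"

definition bdf_quotient :: "nat \<Rightarrow> real \<Rightarrow> (nat \<Rightarrow> 'a \<Rightarrow> real) \<Rightarrow> nat \<Rightarrow> 'a \<Rightarrow> real" where
  "bdf_quotient k dt \<phi> n = (\<lambda>x. (bdf_alpha k * \<phi> (Suc n) x - bdf_A_fun k \<phi> n x) / dt)"

text \<open>
  Step 1, computing level \<open>Suc n\<close>. The sequence \<open>rt\<close> stands for $\tilde r$; its value has to be
  positive for $\ln(\tilde r^{n+1})$ to be meaningful (\<open>ln\<close> is total in HOL).
\<close>

definition resav_step1 ::
    "'a::euclidean_space set \<Rightarrow>
     ('a \<Rightarrow> real) set \<Rightarrow> (('a \<Rightarrow> real) \<Rightarrow> 'a \<Rightarrow> real) \<Rightarrow>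
     ('a \<Rightarrow> real) set \<Rightarrow> (('a \<Rightarrow> real) \<Rightarrow> 'a \<Rightarrow> real) \<Rightarrow>
     (real \<Rightarrow> real) \<Rightarrow> nat \<Rightarrow> real \<Rightarrow>
     (nat \<Rightarrow> 'a \<Rightarrow> real) \<Rightarrow> (nat \<Rightarrow> 'a \<Rightarrow> real) \<Rightarrow> (nat \<Rightarrow> real) \<Rightarrow> (nat \<Rightarrow> real) \<Rightarrow> nat \<Rightarrow> bool" where
  "resav_step1 \<Omega> DL \<L> DG \<G> F k dt \<phi> \<mu> rt r n \<longleftrightarrow>
     \<phi> (Suc n) \<in> DL \<and> \<mu> (Suc n) \<in> DG \<and> 0 < rt (Suc n) \<and>
     U_defined \<Omega> F (bdf_B_fun k \<phi> n) \<and> E1_defined \<Omega> F (\<phi> (Suc n)) \<and>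
     ae_eq \<Omega> (bdf_quotient k dt \<phi> n) (\<lambda>x. - \<G> (\<mu> (Suc n)) x) \<and>
     ae_eq \<Omega> (\<mu> (Suc n))
       (\<lambda>x. \<L> (\<phi> (Suc n)) x + U \<Omega> F (bdf_B k r n) (bdf_B_fun k \<phi> n) x) \<and>
     (bdf_alpha k * ln (rt (Suc n)) - bdf_A k (\<lambda>m. ln (r m)) n) / dt
       = L2_inner \<Omega> (U \<Omega> F (bdf_B k r n) (bdf_B_fun k \<phi> n)) (bdf_quotient k dt \<phi> n)"

text \<open>
  Step 2. Below, \<open>rt\<close> and \<open>e\<close> are the numbers $\tilde r^{n+1}$ and $\exp(E_1(\phi^{n+1}))$, and
  \<open>q\<close> is the dissipation $(\mathcal G\mu^{n+1},\mu^{n+1})$.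
\<close>

definition relaxed_r :: "real \<Rightarrow> real \<Rightarrow> real \<Rightarrow> real" where
  "relaxed_r rt e \<theta> = \<theta> * rt + (1 - \<theta>) * e"

definition W :: "nat \<Rightarrow> real \<Rightarrow> real \<Rightarrow> real \<Rightarrow> real \<Rightarrow> real \<Rightarrow> real set" where
  "W k dt \<gamma> q rt e =
     {\<theta> \<in> {0..1}. bdf_alpha k * ln (relaxed_r rt e \<theta>) - bdf_alpha k * ln rt \<le> dt * \<gamma> * q}"

definition S :: "nat \<Rightarrow> real \<Rightarrow> real \<Rightarrow> real \<Rightarrow> real \<Rightarrow> real" where
  "S k dt \<gamma> q rt =
     (if k = 1 then exp (dt * \<gamma> * q + ln rt) else exp (2/3 * dt * \<gamma> * q + ln rt))"

definition theta_choice :: "real \<Rightarrow> real \<Rightarrow> real \<Rightarrow> real" where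
  "theta_choice s rt e =
     (if rt = e then 0
      else if rt > e then 0
      else if s - e \<ge> 0 then 0
      else (s - e) / (rt - e))"

section \<open>Modified energies\<close>

definition R1 :: "'a::euclidean_space set \<Rightarrow> (('a \<Rightarrow> real) \<Rightarrow> 'a \<Rightarrow> real) \<Rightarrow>
    (nat \<Rightarrow> 'a \<Rightarrow> real) \<Rightarrow> (nat \<Rightarrow> real) \<Rightarrow> nat \<Rightarrow> real" where
  "R1 \<Omega> \<L> \<phi> r n = 1/2 * L2_inner \<Omega> (\<L> (\<phi> n)) (\<phi> n) + ln (r n)"

text \<open>\<open>R2\<close> is only meaningful at levels \<open>n \<ge> 1\<close>.\<close>

definition R2 :: "'a::euclidean_space set \<Rightarrow> (('a \<Rightarrow> real) \<Rightarrow> 'a \<Rightarrow> real) \<Rightarrow>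
    (nat \<Rightarrow> 'a \<Rightarrow> real) \<Rightarrow> (nat \<Rightarrow> real) \<Rightarrow> nat \<Rightarrow> real" where
  "R2 \<Omega> \<L> \<phi> r n =
     (let \<psi> = (\<lambda>x. 2 * \<phi> n x - \<phi> (n - 1) x) in
      1/4 * (L2_inner \<Omega> (\<L> (\<phi> n)) (\<phi> n) + L2_inner \<Omega> (\<L> \<psi>) \<psi>)
      + 1/2 * (3 * ln (r n) - ln (r (n - 1))))"

end

theory Submission
  imports Defs
begin

text \<open>
  Testing the first equation of Step 1 with \<open>\<mu>\<close> and inserting the second and third ones cancels
  the nonlinear terms exactly, so that \<open>\<alpha>\<^sub>k ln rt - A\<^sub>k (ln r)\<close> plus \<open>dt\<close> times the inner
  product of \<open>\<L>\<phi>\<close> with the BDF quotient equals \<open>- dt q\<close>. That second term dominates the increment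
  of the quadratic part of the modified energy (a polarization identity whose remainder is a
  nonnegative square). Replacing \<open>rt\<close> by \<open>r\<close> costs at most \<open>dt \<gamma> q\<close>, because \<open>r \<le> S\<close> in every
  case: \<open>r = min e S\<close> unless \<open>e \<le> rt\<close>, when \<open>r = e \<le> rt \<le> S\<close>.
\<close>

section \<open>Vector space structure and inner product of square integrable functions\<close>

lemma L2_lincomb:
  assumes f: "f \<in> L2 \<Omega>" and g: "g \<in> L2 \<Omega>"
  shows "(\<lambda>x. a * f x + b * g x) \<in> L2 \<Omega>"
proof -
  let ?M = "lebesgue_on \<Omega>"
  have m: "f \<in> borel_measurable ?M" "g \<in> borel_measurable ?M"
    and i: "integrable ?M (\<lambda>x. (f x)\<^sup>2)" "integrable ?M (\<lambda>x. (g x)\<^sup>2)"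
    using f g by (auto simp: L2_def)
  have "integrable ?M (\<lambda>x. (a * f x + b * g x)\<^sup>2)"
  proof (rule Bochner_Integration.integrable_bound)
    show "integrable ?M (\<lambda>x. 2 * a\<^sup>2 * (f x)\<^sup>2 + 2 * b\<^sup>2 * (g x)\<^sup>2)"
      using i by (intro Bochner_Integration.integrable_add integrable_mult_right) auto
    \<comment> \<open>The two sides differ by \<open>(a * s - b * t)\<^sup>2\<close>.\<close>
    have "(a * s + b * t)\<^sup>2 \<le> 2 * a\<^sup>2 * s\<^sup>2 + 2 * b\<^sup>2 * t\<^sup>2" for s t :: real
      using zero_le_power2[of "a * s - b * t"] by (simp add: power2_eq_square algebra_simps)
    then show "AE x in ?M. norm ((a * f x + b * g x)\<^sup>2)
        \<le> norm (2 * a\<^sup>2 * (f x)\<^sup>2 + 2 * b\<^sup>2 * (g x)\<^sup>2)"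
      by simp
  qed (use m in measurable)
  with m show ?thesis
    by (simp add: L2_def)
qed

lemma L2_scale:
  assumes "f \<in> L2 \<Omega>"
  shows "(\<lambda>x. c * f x) \<in> L2 \<Omega>"
  using L2_lincomb[OF assms assms, of c 0] by simp

lemma integrable_L2_mult:
  assumes f: "f \<in> L2 \<Omega>" and g: "g \<in> L2 \<Omega>"
  shows "integrable (lebesgue_on \<Omega>) (\<lambda>x. f x * g x)"
proof (rule Bochner_Integration.integrable_bound)
  show "integrable (lebesgue_on \<Omega>) (\<lambda>x. (f x)\<^sup>2 + (g x)\<^sup>2)"
    using f g by (auto simp: L2_def)
  show "(\<lambda>x. f x * g x) \<in> borel_measurable (lebesgue_on \<Omega>)"
    using f g by (auto simp: L2_def)
  have "\<bar>s * t\<bar> \<le> s\<^sup>2 + t\<^sup>2" for s t :: real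
  proof -
    have "0 \<le> \<bar>s\<bar> * \<bar>t\<bar>"
      by simp
    moreover have "2 * (\<bar>s\<bar> * \<bar>t\<bar>) \<le> s\<^sup>2 + t\<^sup>2"
      using sum_squares_bound[of "\<bar>s\<bar>" "\<bar>t\<bar>"] by (simp add: mult.assoc)
    ultimately show ?thesis
      unfolding abs_mult by linarith
  qed
  then show "AE x in lebesgue_on \<Omega>. norm (f x * g x) \<le> norm ((f x)\<^sup>2 + (g x)\<^sup>2)"
    by simp
qed

lemma L2_inner_commute: "L2_inner \<Omega> f g = L2_inner \<Omega> g f"
  by (simp add: L2_inner_def mult.commute)

lemma L2_inner_lincomb_right:
  assumes "f \<in> L2 \<Omega>" "g \<in> L2 \<Omega>" "h \<in> L2 \<Omega>"
  shows "L2_inner \<Omega> h (\<lambda>x. a * f x + b * g x) = a * L2_inner \<Omega> h f + b * L2_inner \<Omega> h g"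
proof -
  have "L2_inner \<Omega> h (\<lambda>x. a * f x + b * g x)
      = (LINT x|lebesgue_on \<Omega>. a * (h x * f x) + b * (h x * g x))"
    unfolding L2_inner_def by (simp add: algebra_simps)
  also have "\<dots> = a * L2_inner \<Omega> h f + b * L2_inner \<Omega> h g"
    using integrable_L2_mult[OF assms(3,1)] integrable_L2_mult[OF assms(3,2)]
    by (simp add: L2_inner_def)
  finally show ?thesis .
qed

text \<open>The equations of Step 1 hold only almost everywhere; this carries them into inner
  products. Membership in \<open>L2\<close> supplies the measurability that
  \<open>integral_cong_AE\<close> asks for.\<close>

lemma L2_inner_cong_ae:
  assumes "f \<in> L2 \<Omega>" "g \<in> L2 \<Omega>" "h \<in> L2 \<Omega>" "ae_eq \<Omega> f g"
  shows "L2_inner \<Omega> h f = L2_inner \<Omega> h g"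
  unfolding L2_inner_def
  by (rule integral_cong_AE) (use assms in \<open>auto simp: L2_def ae_eq_def\<close>)

section \<open>Quadratic forms of symmetric operators and BDF polarization bounds\<close>

lemma linear_operator_on_lincomb:
  assumes "linear_operator_on \<Omega> D T" "f \<in> D" "g \<in> D"
  shows "(\<lambda>x. a * f x + b * g x) \<in> D"
proof -
  have add: "\<And>u v. u \<in> D \<Longrightarrow> v \<in> D \<Longrightarrow> (\<lambda>x. u x + v x) \<in> D"
    and scale: "\<And>u c. u \<in> D \<Longrightarrow> (\<lambda>x. c * u x) \<in> D"
    using assms(1) by (simp_all add: linear_operator_on_def)
  show ?thesis
    by (rule add[OF scale[OF assms(2)] scale[OF assms(3)]])
qed

lemma linear_operator_on_L2:
  assumes "linear_operator_on \<Omega> D T" "f \<in> D"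
  shows "f \<in> L2 \<Omega>" "T f \<in> L2 \<Omega>"
  using assms unfolding linear_operator_on_def by auto

lemma operator_form_commute:
  assumes "self_adjoint_on \<Omega> D T" "f \<in> D" "g \<in> D"
  shows "L2_inner \<Omega> (T f) g = L2_inner \<Omega> (T g) f"
  using assms L2_inner_commute unfolding self_adjoint_on_def by metis

lemma operator_form_lincomb_right:
  assumes "linear_operator_on \<Omega> D T" "f \<in> D" "g \<in> D" "h \<in> D"
  shows "L2_inner \<Omega> (T h) (\<lambda>x. a * f x + b * g x)
    = a * L2_inner \<Omega> (T h) f + b * L2_inner \<Omega> (T h) g"
  using assms by (intro L2_inner_lincomb_right linear_operator_on_L2)

text \<open>Symmetry swaps the combination into the right slot, so linearity of the inner product in
  its second argument expands both slots.\<close>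

lemma operator_form_lincomb_diag:
  assumes T: "linear_operator_on \<Omega> D T" "self_adjoint_on \<Omega> D T" and f: "f \<in> D" and g: "g \<in> D"
  shows "L2_inner \<Omega> (T (\<lambda>x. a * f x + b * g x)) (\<lambda>x. a * f x + b * g x)
    = a\<^sup>2 * L2_inner \<Omega> (T f) f + 2 * a * b * L2_inner \<Omega> (T f) g + b\<^sup>2 * L2_inner \<Omega> (T g) g"
proof -
  let ?h = "\<lambda>x. a * f x + b * g x"
  have h: "?h \<in> D"
    using linear_operator_on_lincomb[OF T(1) f g] .
  have "L2_inner \<Omega> (T ?h) ?h = a * L2_inner \<Omega> (T ?h) f + b * L2_inner \<Omega> (T ?h) g"
    by (rule operator_form_lincomb_right[OF T(1) f g h])
  also have "L2_inner \<Omega> (T ?h) f = a * L2_inner \<Omega> (T f) f + b * L2_inner \<Omega> (T f) g"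
    using operator_form_commute[OF T(2) h f] operator_form_lincomb_right[OF T(1) f g f] by simp
  also have "L2_inner \<Omega> (T ?h) g = a * L2_inner \<Omega> (T f) g + b * L2_inner \<Omega> (T g) g"
    using operator_form_commute[OF T(2) h g] operator_form_lincomb_right[OF T(1) f g g]
      operator_form_commute[OF T(2) f g] by simp
  finally show ?thesis
    by (simp add: power2_eq_square algebra_simps)
qed

text \<open>The right side exceeds the left by half of the form at \<open>f - g\<close>.\<close>

lemma bdf1_form_bound:
  assumes T: "linear_operator_on \<Omega> D T" "self_adjoint_on \<Omega> D T" "nonnegative_on \<Omega> D T"
    and f: "f \<in> D" and g: "g \<in> D"
  shows "1/2 * L2_inner \<Omega> (T f) f - 1/2 * L2_inner \<Omega> (T g) g
    \<le> L2_inner \<Omega> (T f) (\<lambda>x. 1 * f x + (-1) * g x)"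
proof -
  have "0 \<le> L2_inner \<Omega> (T (\<lambda>x. 1 * f x + (-1) * g x)) (\<lambda>x. 1 * f x + (-1) * g x)"
    using T(3) linear_operator_on_lincomb[OF T(1) f g] unfolding nonnegative_on_def by blast
  then show ?thesis
    unfolding operator_form_lincomb_diag[OF T(1,2) f g]
      operator_form_lincomb_right[OF T(1) f g f] by simp
qed

text \<open>
  The difference of the two sides is a quarter of the form at \<open>f - 2g + h\<close>.
\<close>

lemma bdf2_form_bound:
  assumes T: "linear_operator_on \<Omega> D T" "self_adjoint_on \<Omega> D T" "nonnegative_on \<Omega> D T"
    and f: "f \<in> D" and g: "g \<in> D" and h: "h \<in> D"
  shows "1/4 * (L2_inner \<Omega> (T f) f
        + L2_inner \<Omega> (T (\<lambda>x. 2 * f x + (-1) * g x)) (\<lambda>x. 2 * f x + (-1) * g x))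
      - 1/4 * (L2_inner \<Omega> (T g) g
        + L2_inner \<Omega> (T (\<lambda>x. 2 * g x + (-1) * h x)) (\<lambda>x. 2 * g x + (-1) * h x))
    \<le> L2_inner \<Omega> (T f) (\<lambda>x. 3/2 * f x + 1 * ((-2) * g x + 1/2 * h x))"
proof -
  \<comment> \<open>The expansion lemmas combine two functions, so three-term combinations are
    nested: \<open>f + ?w\<close> is the second difference, and \<open>?v\<close> is the tail of the
    BDF2 numerator.\<close>
  let ?w = "\<lambda>x. (-2) * g x + 1 * h x"
  let ?v = "\<lambda>x. (-2) * g x + 1/2 * h x"
  have w: "?w \<in> D" and v: "?v \<in> D"
    using linear_operator_on_lincomb[OF T(1) g h] by blast+
  have "0 \<le> L2_inner \<Omega> (T (\<lambda>x. 1 * f x + 1 * ?w x)) (\<lambda>x. 1 * f x + 1 * ?w x)"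
    using T(3) linear_operator_on_lincomb[OF T(1) f w] unfolding nonnegative_on_def by blast
  then show ?thesis
    unfolding operator_form_lincomb_diag[OF T(1,2) f w]
      operator_form_lincomb_diag[OF T(1,2) g h] operator_form_lincomb_diag[OF T(1,2) f g]
      operator_form_lincomb_right[OF T(1) f v f] operator_form_lincomb_right[OF T(1) g h f]
    by (simp add: algebra_simps)
qed

section \<open>Exact energy balance of Step 1\<close>

lemma L2_inner_dissipation:
  assumes Q: "Q \<in> L2 \<Omega>" and m: "m \<in> L2 \<Omega>" and g: "g \<in> L2 \<Omega>"
    and l: "l \<in> L2 \<Omega>" and u: "u \<in> L2 \<Omega>"
    and Qg: "ae_eq \<Omega> Q (\<lambda>x. - g x)" and mlu: "ae_eq \<Omega> m (\<lambda>x. l x + u x)"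
  shows "L2_inner \<Omega> l Q + L2_inner \<Omega> u Q = - L2_inner \<Omega> g m"
proof -
  have g': "(\<lambda>x. - g x) \<in> L2 \<Omega>"
    using L2_scale[OF g, of "-1"] by simp
  have lu: "(\<lambda>x. l x + u x) \<in> L2 \<Omega>"
    using L2_lincomb[OF l u, of 1 1] by simp
  have "L2_inner \<Omega> l Q + L2_inner \<Omega> u Q = L2_inner \<Omega> Q (\<lambda>x. l x + u x)"
    using L2_inner_lincomb_right[OF l u Q, of 1 1] by (simp add: L2_inner_commute[of \<Omega> _ Q])
  also have "\<dots> = L2_inner \<Omega> m Q"
    using L2_inner_cong_ae[OF m lu Q mlu] L2_inner_commute[of \<Omega> m Q] by simp
  also have "\<dots> = L2_inner \<Omega> m (\<lambda>x. - g x)"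
    by (rule L2_inner_cong_ae[OF Q g' m Qg])
  also have "\<dots> = - L2_inner \<Omega> g m"
    by (simp add: L2_inner_def mult.commute)
  finally show ?thesis .
qed

lemma U_in_L2:
  assumes "U_defined \<Omega> F \<phi>"
  shows "U \<Omega> F c \<phi> \<in> L2 \<Omega>"
  unfolding U_def by (rule L2_scale) (use assms in \<open>simp add: U_defined_def\<close>)

text \<open>Both schemes share this identity. The premise \<open>num\<close>, which follows from
  closure of \<open>DL\<close> under linear combinations, puts the BDF numerator in
  \<open>L2\<close>, so that every pairing is linear.\<close>

lemma resav_step1_energy:
  assumes L: "linear_operator_on \<Omega> DL \<L>" and G: "linear_operator_on \<Omega> DG \<G>"
    and dt: "0 < dt"
    and step: "resav_step1 \<Omega> DL \<L> DG \<G> F k dt \<phi> \<mu> rt r n"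
    and num: "(\<lambda>x. bdf_alpha k * \<phi> (Suc n) x - bdf_A_fun k \<phi> n x) \<in> DL"
  shows "bdf_alpha k * ln (rt (Suc n)) - bdf_A k (\<lambda>m. ln (r m)) n
      + L2_inner \<Omega> (\<L> (\<phi> (Suc n))) (\<lambda>x. bdf_alpha k * \<phi> (Suc n) x - bdf_A_fun k \<phi> n x)
    = - dt * L2_inner \<Omega> (\<G> (\<mu> (Suc n))) (\<mu> (Suc n))"
proof -
  define d where "d = (\<lambda>x. bdf_alpha k * \<phi> (Suc n) x - bdf_A_fun k \<phi> n x)"
  define u where "u = U \<Omega> F (bdf_B k r n) (bdf_B_fun k \<phi> n)"
  define a where "a = bdf_alpha k * ln (rt (Suc n)) - bdf_A k (\<lambda>m. ln (r m)) n"
  define f where "f = \<phi> (Suc n)"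
  define m where "m = \<mu> (Suc n)"
  note step' = step[unfolded resav_step1_def bdf_quotient_def, folded a_def u_def f_def m_def]
  \<comment> \<open>Writing the quotient as a scalar multiple of \<open>d\<close> lets
    \<open>1/dt\<close> be pulled out of the inner products.\<close>
  have Q_eq: "(\<lambda>x. (bdf_alpha k * f x - bdf_A_fun k \<phi> n x) / dt) = (\<lambda>x. 1/dt * d x)"
    by (simp add: d_def f_def)
  have f: "f \<in> DL" and m: "m \<in> DG" and U: "U_defined \<Omega> F (bdf_B_fun k \<phi> n)"
    and Qg: "ae_eq \<Omega> (\<lambda>x. 1/dt * d x) (\<lambda>x. - \<G> m x)"
    and mlu: "ae_eq \<Omega> m (\<lambda>x. \<L> f x + u x)"
    and a: "a / dt = L2_inner \<Omega> u (\<lambda>x. 1/dt * d x)"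
    using step'[unfolded Q_eq] by blast+
  have d: "d \<in> L2 \<Omega>"
    using linear_operator_on_L2(1)[OF L num] by (simp only: d_def)
  have u: "u \<in> L2 \<Omega>"
    unfolding u_def by (rule U_in_L2[OF U])
  note Lf = linear_operator_on_L2(2)[OF L f]
  have "L2_inner \<Omega> (\<L> f) (\<lambda>x. 1/dt * d x) + a / dt = - L2_inner \<Omega> (\<G> m) m"
    unfolding a
    by (rule L2_inner_dissipation[OF L2_scale[OF d] linear_operator_on_L2[OF G m] Lf u Qg mlu])
  moreover have "L2_inner \<Omega> (\<L> f) (\<lambda>x. 1/dt * d x) = L2_inner \<Omega> (\<L> f) d / dt"
    using L2_inner_lincomb_right[OF d d Lf, of "1/dt" 0] by simp
  ultimately have "(a + L2_inner \<Omega> (\<L> f) d) / dt = - L2_inner \<Omega> (\<G> m) m"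
    by (simp add: add_divide_distrib)
  then have "a + L2_inner \<Omega> (\<L> f) d = - dt * L2_inner \<Omega> (\<G> m) m"
    using dt by (simp add: divide_eq_eq mult.commute)
  then show ?thesis
    by (simp only: a_def d_def f_def m_def)
qed

section \<open>Admissibility of the relaxation parameter\<close>

text \<open>The factors 1 and 2/3 in \<open>S\<close> are the reciprocals of
  \<open>bdf_alpha k\<close>. Hence \<open>S\<close> is the largest positive value of r that
  satisfies the logarithmic inequality in \<open>W\<close>.\<close>

lemma S_eq:
  assumes "0 < rt" "k = 1 \<or> k = 2"
  shows "S k dt \<gamma> q rt = rt * exp (dt * \<gamma> * q / bdf_alpha k)"
  using assms by (auto simp: S_def bdf_alpha_def exp_add exp_ln mult.commute)

lemma theta_choice_relaxation:
  assumes rt: "0 < rt" and e: "0 < e" and s: "rt \<le> s"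
  defines "th \<equiv> theta_choice s rt e"
  shows "th \<in> {0..1}" "(rt - e) * th \<le> s - e"
    "0 < relaxed_r rt e th" "relaxed_r rt e th \<le> s" "relaxed_r rt e th \<le> e"
proof -
  have "th \<in> {0..1} \<and> (rt - e) * th \<le> s - e \<and> 0 < relaxed_r rt e th \<and>
    relaxed_r rt e th \<le> s \<and> relaxed_r rt e th \<le> e"
  \<comment> \<open>The first case collects the three branches with parameter 0; there
    \<open>e \<le> s\<close> holds throughout, since \<open>rt \<le> s\<close>. The second case
    means \<open>rt \<le> s < e\<close>.\<close>
  proof (cases "e \<le> rt \<or> e \<le> s")
    case True
    then have "th = 0"
      by (auto simp: th_def theta_choice_def)
    with True e s show ?thesis
      by (auto simp: relaxed_r_def)
  next
    case False
    then have th: "th = (s - e) / (rt - e)"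
      by (auto simp: th_def theta_choice_def)
    then have prod: "(rt - e) * th = s - e"
      using False by simp
    \<comment> \<open>With \<open>prod\<close> this makes the relaxed value exactly
      \<open>s\<close>, which is positive because \<open>rt \<le> s\<close>.\<close>
    moreover have "relaxed_r rt e th = (rt - e) * th + e"
      by (simp add: relaxed_r_def algebra_simps)
    moreover have "th \<in> {0..1}"
      using False s by (simp add: th field_simps)
    ultimately show ?thesis
      using False rt s by simp
  qed
  then show "th \<in> {0..1}" "(rt - e) * th \<le> s - e"
    "0 < relaxed_r rt e th" "relaxed_r rt e th \<le> s" "relaxed_r rt e th \<le> e"
    by auto
qed

lemma theta_choice_admissible:
  assumes k: "k = 1 \<or> k = 2" and rt: "0 < rt" and e: "0 < e" and diss: "0 \<le> dt * \<gamma> * q"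
  defines "th \<equiv> theta_choice (S k dt \<gamma> q rt) rt e"
  shows "th \<in> W k dt \<gamma> q rt e"
    and "(rt - e) * th \<le> S k dt \<gamma> q rt - e"
    and "0 < relaxed_r rt e th"
    and "relaxed_r rt e th \<le> e"
    and "bdf_alpha k * ln (relaxed_r rt e th) - bdf_alpha k * ln rt \<le> dt * \<gamma> * q"
proof -
  have alpha: "0 < bdf_alpha k"
    by (simp add: bdf_alpha_def)
  note s = S_eq[OF rt k, of dt \<gamma> q]
  \<comment> \<open>Nonnegative dissipation makes the exponential factor at least 1.\<close>
  have "rt \<le> S k dt \<gamma> q rt"
    unfolding s using rt diss alpha by simp
  note th = theta_choice_relaxation[OF rt e this, folded th_def]
  have "ln (relaxed_r rt e th) \<le> ln (S k dt \<gamma> q rt)"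
    by (rule ln_mono[OF th(4,3)])
  also have "\<dots> = ln rt + dt * \<gamma> * q / bdf_alpha k"
    unfolding s using rt by (simp add: ln_mult)
  finally show ln_le: "bdf_alpha k * ln (relaxed_r rt e th) - bdf_alpha k * ln rt \<le> dt * \<gamma> * q"
    using alpha by (simp add: field_simps)
  show "th \<in> W k dt \<gamma> q rt e"
    using th(1) ln_le by (simp add: W_def)
  show "(rt - e) * th \<le> S k dt \<gamma> q rt - e" "0 < relaxed_r rt e th" "relaxed_r rt e th \<le> e"
    by (rule th)+
qed

section \<open>Decay of the modified energies\<close>

text \<open>The number \<open>c\<close> is the price of replacing \<open>rt\<close> by
  \<open>r\<close>; it is added to the Step 1 balance, whose form term is bounded below by the
  energy increment.\<close>

lemma resav_R1_decrease:
  assumes L: "linear_operator_on \<Omega> DL \<L>" "self_adjoint_on \<Omega> DL \<L>" "nonnegative_on \<Omega> DL \<L>"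
    and G: "linear_operator_on \<Omega> DG \<G>" and dt: "0 < dt"
    and step: "resav_step1 \<Omega> DL \<L> DG \<G> F 1 dt \<phi> \<mu> rt r n"
    and dom: "\<phi> n \<in> DL"
    and ln_le: "bdf_alpha 1 * ln (r (Suc n)) - bdf_alpha 1 * ln (rt (Suc n)) \<le> c"
  shows "R1 \<Omega> \<L> \<phi> r (Suc n) - R1 \<Omega> \<L> \<phi> r n
    \<le> c - dt * L2_inner \<Omega> (\<G> (\<mu> (Suc n))) (\<mu> (Suc n))"
proof -
  let ?d = "\<lambda>x. 1 * \<phi> (Suc n) x + (-1) * \<phi> n x"
  have f: "\<phi> (Suc n) \<in> DL"
    using step by (simp add: resav_step1_def)
  have d: "(\<lambda>x. bdf_alpha 1 * \<phi> (Suc n) x - bdf_A_fun 1 \<phi> n x) = ?d"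
    by (simp add: bdf_alpha_def bdf_A_fun_def bdf_A_def)
  have "?d \<in> DL"
    by (rule linear_operator_on_lincomb[OF L(1) f dom])
  then show ?thesis
    using resav_step1_energy[OF L(1) G dt step, unfolded d] bdf1_form_bound[OF L f dom] ln_le
    by (simp add: R1_def bdf_alpha_def bdf_A_def)
qed

text \<open>The weights 3 and -1 in \<open>R2\<close> are chosen so that the increment of its
  logarithmic part is exactly \<open>bdf_alpha 2 * ln (r (Suc n)) - bdf_A 2 (\<lambda>m. ln (r m))
  n\<close>. The rest is as for BDF1.\<close>

lemma resav_R2_decrease:
  assumes L: "linear_operator_on \<Omega> DL \<L>" "self_adjoint_on \<Omega> DL \<L>" "nonnegative_on \<Omega> DL \<L>"
    and G: "linear_operator_on \<Omega> DG \<G>" and dt: "0 < dt"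
    and step: "resav_step1 \<Omega> DL \<L> DG \<G> F 2 dt \<phi> \<mu> rt r n"
    and dom: "\<phi> n \<in> DL" "\<phi> (n - 1) \<in> DL"
    and ln_le: "bdf_alpha 2 * ln (r (Suc n)) - bdf_alpha 2 * ln (rt (Suc n)) \<le> c"
  shows "R2 \<Omega> \<L> \<phi> r (Suc n) - R2 \<Omega> \<L> \<phi> r n
    \<le> c - dt * L2_inner \<Omega> (\<G> (\<mu> (Suc n))) (\<mu> (Suc n))"
proof -
  let ?d = "\<lambda>x. 3/2 * \<phi> (Suc n) x + 1 * ((-2) * \<phi> n x + 1/2 * \<phi> (n - 1) x)"
  have f: "\<phi> (Suc n) \<in> DL"
    using step by (simp add: resav_step1_def)
  have d: "(\<lambda>x. bdf_alpha 2 * \<phi> (Suc n) x - bdf_A_fun 2 \<phi> n x) = ?d"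
    by (simp add: bdf_alpha_def bdf_A_fun_def bdf_A_def fun_eq_iff)
  have "?d \<in> DL"
    by (rule linear_operator_on_lincomb[OF L(1) f linear_operator_on_lincomb[OF L(1) dom]])
  note energy = resav_step1_energy[OF L(1) G dt step, unfolded d, OF this]
  from energy bdf2_form_bound[OF L f dom] ln_le show ?thesis
    by (simp add: R2_def Let_def bdf_alpha_def bdf_A_def add_divide_distrib diff_divide_distrib)
qed

text \<open>Levels below \<open>k\<close> are initial data, so \<open>k \<le> Suc n\<close> says
  that level \<open>Suc n\<close> is computed by the scheme; \<open>N\<close> is the last computed
  level.\<close>

theorem theorem2p1:
  fixes \<Omega> :: "'a::euclidean_space set"
    and \<L> \<G> :: "('a \<Rightarrow> real) \<Rightarrow> 'a \<Rightarrow> real"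
    and DL DG :: "('a \<Rightarrow> real) set"
    and F :: "real \<Rightarrow> real"
    and k N :: nat
    and dt \<gamma> :: real
    and \<phi> \<mu> :: "nat \<Rightarrow> 'a \<Rightarrow> real"
    and r rt \<theta> :: "nat \<Rightarrow> real"
  defines "e \<equiv> \<lambda>n. exp (E1 \<Omega> F (\<phi> n))"
    and "q \<equiv> \<lambda>n. L2_inner \<Omega> (\<G> (\<mu> n)) (\<mu> n)"
  assumes Omega: "\<Omega> \<in> sets lebesgue"
    and L: "linear_operator_on \<Omega> DL \<L>" "self_adjoint_on \<Omega> DL \<L>" "nonnegative_on \<Omega> DL \<L>"
    and G: "linear_operator_on \<Omega> DG \<G>" "nonnegative_on \<Omega> DG \<G>"
    and k: "k = 1 \<or> k = 2"
    and dt: "0 < dt"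
    and gamma: "0 \<le> \<gamma>" "\<gamma> \<le> 1"
    and init: "\<And>m. m < k \<Longrightarrow> \<phi> m \<in> DL \<and> 0 < r m"
    and step1: "\<And>n. k \<le> Suc n \<Longrightarrow> n < N \<Longrightarrow> resav_step1 \<Omega> DL \<L> DG \<G> F k dt \<phi> \<mu> rt r n"
    and theta: "\<And>n. k \<le> Suc n \<Longrightarrow> n < N \<Longrightarrow>
      \<theta> (Suc n) = theta_choice (S k dt \<gamma> (q (Suc n)) (rt (Suc n))) (rt (Suc n)) (e (Suc n))"
    and step2: "\<And>n. k \<le> Suc n \<Longrightarrow> n < N \<Longrightarrow>
      r (Suc n) = relaxed_r (rt (Suc n)) (e (Suc n)) (\<theta> (Suc n))"
  shows "\<forall>n. k \<le> Suc n \<and> n < N \<longrightarrow>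
    (rt (Suc n) - e (Suc n)) * \<theta> (Suc n) \<le> S k dt \<gamma> (q (Suc n)) (rt (Suc n)) - e (Suc n) \<and>
    \<theta> (Suc n) \<in> W k dt \<gamma> (q (Suc n)) (rt (Suc n)) (e (Suc n)) \<and>
    0 < r (Suc n) \<and>
    (k = 1 \<longrightarrow>
      R1 \<Omega> \<L> \<phi> r (Suc n) - R1 \<Omega> \<L> \<phi> r n \<le> - dt * (1 - \<gamma>) * q (Suc n) \<and>
      - dt * (1 - \<gamma>) * q (Suc n) \<le> 0) \<and>
    (k = 2 \<longrightarrow>
      R2 \<Omega> \<L> \<phi> r (Suc n) - R2 \<Omega> \<L> \<phi> r n \<le> - dt * (1 - \<gamma>) * q (Suc n) \<and>
      - dt * (1 - \<gamma>) * q (Suc n) \<le> 0) \<and>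
    r (Suc n) \<le> e (Suc n)"
proof (intro allI impI)
  fix n
  assume "k \<le> Suc n \<and> n < N"
  then have kn: "k \<le> Suc n" and nN: "n < N"
    by simp_all
  \<comment> \<open>Old levels lie in \<open>DL\<close> either as initial data or as output of an
    earlier Step 1.\<close>
  have dom: "\<phi> m \<in> DL" if "m \<le> N" for m
  proof (cases "m < k")
    case True
    then show ?thesis
      using init by simp
  next
    case False
    with k that obtain m' where "m = Suc m'" "k \<le> Suc m'" "m' < N"
      by (cases m) auto
    then show ?thesis
      using step1[of m'] by (simp add: resav_step1_def)
  qed
  note step = step1[OF kn nN]
  have rt: "0 < rt (Suc n)" and \<mu>: "\<mu> (Suc n) \<in> DG"
    using step by (simp_all add: resav_step1_def)
  have q: "0 \<le> q (Suc n)"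
    using G(2) \<mu> by (simp add: nonnegative_on_def q_def)
  have e: "0 < e (Suc n)"
    by (simp add: e_def)
  have "0 \<le> dt * \<gamma> * q (Suc n)"
    using dt gamma(1) q by simp
  \<comment> \<open>Folding turns the chosen parameter into \<open>\<theta> (Suc n)\<close> and the
    relaxed value into \<open>r (Suc n)\<close>.\<close>
  note adm = theta_choice_admissible[OF k rt e this, folded theta[OF kn nN] step2[OF kn nN]]
  have dissip: "- dt * (1 - \<gamma>) * q (Suc n) \<le> 0"
    using dt gamma(2) q by simp
  have rate: "dt * \<gamma> * q (Suc n) - dt * L2_inner \<Omega> (\<G> (\<mu> (Suc n))) (\<mu> (Suc n))
      = - dt * (1 - \<gamma>) * q (Suc n)"
    by (simp add: q_def algebra_simps)
  \<comment> \<open>The second fact serves BDF2, where \<open>k \<le> Suc n\<close> gives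
    \<open>1 \<le> n\<close>; at \<open>n = 0\<close> truncated subtraction makes it repeat the
    first.\<close>
  have dom_n: "\<phi> n \<in> DL" "\<phi> (n - 1) \<in> DL"
    using dom nN by simp_all
  have R1: "R1 \<Omega> \<L> \<phi> r (Suc n) - R1 \<Omega> \<L> \<phi> r n \<le> - dt * (1 - \<gamma>) * q (Suc n)" if "k = 1"
    using resav_R1_decrease[OF L G(1) dt step[unfolded that] dom_n(1) adm(5)[unfolded that]]
    by (simp only: rate)
  have R2: "R2 \<Omega> \<L> \<phi> r (Suc n) - R2 \<Omega> \<L> \<phi> r n \<le> - dt * (1 - \<gamma>) * q (Suc n)" if "k = 2"
    using resav_R2_decrease[OF L G(1) dt step[unfolded that] dom_n adm(5)[unfolded that]]
    by (simp only: rate)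
  show "(rt (Suc n) - e (Suc n)) * \<theta> (Suc n) \<le> S k dt \<gamma> (q (Suc n)) (rt (Suc n)) - e (Suc n) \<and>
    \<theta> (Suc n) \<in> W k dt \<gamma> (q (Suc n)) (rt (Suc n)) (e (Suc n)) \<and>
    0 < r (Suc n) \<and>
    (k = 1 \<longrightarrow>
      R1 \<Omega> \<L> \<phi> r (Suc n) - R1 \<Omega> \<L> \<phi> r n \<le> - dt * (1 - \<gamma>) * q (Suc n) \<and>
      - dt * (1 - \<gamma>) * q (Suc n) \<le> 0) \<and>
    (k = 2 \<longrightarrow>
      R2 \<Omega> \<L> \<phi> r (Suc n) - R2 \<Omega> \<L> \<phi> r n \<le> - dt * (1 - \<gamma>) * q (Suc n) \<and>
      - dt * (1 - \<gamma>) * q (Suc n) \<le> 0) \<and>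
    r (Suc n) \<le> e (Suc n)"
    using adm(1-4) R1 R2 dissip by simp
qed

end
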